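(* Let $r\in(0,1)$ and let $K$ be a positive integer. Define the intervals $I_k = \left[\tfrac{r^k}{2},\tfrac{r^{k-1}}{2}\right)$ for $k\in\{1,2,\ldots,K-1\}$ and $I_K = \left(0,\tfrac{r^{K-1}}{2}\right)$, which partition $(0,\tfrac12)$. Let $D = D^{(r,K)}$ be the function on $(0,1)$ which is anti-symmetric about $u=\tfrac12$ (that is, $D(1-u)=-D(u)$) and which on each $I_k$ satisfies $D(u)=D_k(u)$ for $u\in I_k$, where $$D_k = \operatorname*{argmin}_{D'\in\mathcal{P}_1}\int_{I_k}\left|\Phi^{-1}(u)-D'(u)\right|^2\,du .$$ Then for any real $p$ with $2\le p<\infty$, in the regime $r\to1$ and $r^{K-1}\to0$, $$\lVert D-\Phi^{-1}\rVert_p^p = O\!\left((1-r)^{2p}\right)+O\!\left(r^{K-1}\left(\log\!\left(r^{1-K}\sqrt{2/\pi}\right)\right)^{-p/2}\right) = O\!\left((1-r)^{2p}\right)+o\!\left(r^{K-1}\right).$$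
   Context: $\Phi$ denotes the cumulative distribution function of the standard Gaussian distribution $N(0,1)$ and $\Phi^{-1}\colon(0,1)\to\mathbb{R}$ its inverse. $\mathcal{P}_1$ is the set of real polynomials in $u$ of degree at most $1$. For a measurable function $f$ on $(0,1)$, $\lVert f\rVert_p = \left(\int_0^1|f(u)|^p\,du\right)^{1/p}$. The implied constants in the $O$-notation do not depend on $r$ or $K$. *)

theory Defs
  imports
    "HOL-Probability.Probability"
    "HOL-Computational_Algebra.Polynomial"
    "HOL-Library.Landau_Symbols"
    "HOL-Library.Function_Algebras"
    "HOL-Library.Set_Algebras"
begin

definition Phi :: "real \<Rightarrow> real" where
  "Phi = cdf std_normal_distribution"

text \<open>Only the values on \<open>(0,1)\<close>, the range of \<open>Phi\<close>, are meaningful.\<close>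

definition Phi_inv :: "real \<Rightarrow> real" where
  "Phi_inv = inv Phi"

text \<open>The Bochner integral of a non-integrable function is 0, so this is the usual norm only
  when \<open>\<bar>f\<bar>\<^sup>p\<close> is integrable on \<open>(0,1)\<close>.\<close>

definition Lp_norm :: "real \<Rightarrow> (real \<Rightarrow> real) \<Rightarrow> real" where
  "Lp_norm p f = (LINT u:{0<..<1}|lborel. \<bar>f u\<bar> powr p) powr (1 / p)"

definition geometric_interval :: "real \<Rightarrow> nat \<Rightarrow> nat \<Rightarrow> real set" where
  "geometric_interval r K k =
     (if k < K then {r ^ k / 2 ..< r ^ (k - 1) / 2} else {0 <..< r ^ (K - 1) / 2})"

definition best_linear :: "real \<Rightarrow> nat \<Rightarrow> nat \<Rightarrow> real poly" where
  "best_linear r K k =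
     (ARG_MIN (\<lambda>q. LINT u:geometric_interval r K k|lborel. \<bar>Phi_inv u - poly q u\<bar>\<^sup>2) q. degree q \<le> 1)"

text \<open>Antisymmetry determines \<open>D\<close> on \<open>(1/2,1)\<close> and forces \<open>D (1/2) = 0\<close>; nothing is required of
  \<open>D\<close> outside \<open>(0,1)\<close>.\<close>

definition is_approximant :: "real \<Rightarrow> nat \<Rightarrow> (real \<Rightarrow> real) \<Rightarrow> bool" where
  "is_approximant r K D \<longleftrightarrow>
     (\<forall>u\<in>{0<..<1}. D (1 - u) = - D u) \<and>
     (\<forall>k\<in>{1..K}. \<forall>u\<in>geometric_interval r K k. D u = poly (best_linear r K k) u)"

text \<open>The joint regime \<open>r \<rightarrow> 1\<close> and \<open>r\<^bsup>K-1\<^esup> \<rightarrow> 0\<close>, with \<open>r \<in> (0,1)\<close> and \<open>K \<ge> 1\<close>, as a filter on pairs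
  \<open>(r, K)\<close>. Landau symbols over it have constants uniform in \<open>r\<close> and \<open>K\<close>.\<close>

definition regime :: "(real \<times> nat) filter" where
  "regime =
     inf (inf (filtercomap (\<lambda>(r, K). r) (nhds 1))
              (filtercomap (\<lambda>(r, K). r ^ (K - 1)) (nhds 0)))
         (principal ({0<..<1} \<times> {1..}))"

lemma eventually_regime:
  "eventually P regime \<longleftrightarrow>
     (\<exists>\<delta>>0. \<exists>\<epsilon>>0. \<forall>r K. 0 < r \<and> r < 1 \<and> 1 \<le> K \<and> 1 - r < \<delta> \<and> r ^ (K - 1) < \<epsilon> \<longrightarrow> P (r, K))"
  (is "?L \<longleftrightarrow> ?R")
proof
  assume ?L
  then obtain Q R where QR:
      "eventually Q (filtercomap (\<lambda>(r, K). r) (nhds 1))"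
      "eventually R (filtercomap (\<lambda>(r, K). r ^ (K - 1)) (nhds 0))"
      "\<And>x. Q x \<Longrightarrow> R x \<Longrightarrow> x \<in> {0<..<1} \<times> {1..} \<Longrightarrow> P x"
    unfolding regime_def eventually_inf_principal by (auto simp: eventually_inf)
  from QR(1) obtain Q' where Q': "eventually Q' (nhds (1::real))" "\<And>r K. Q' r \<Longrightarrow> Q (r, K)"
    unfolding eventually_filtercomap by auto
  from QR(2) obtain R' where
      R': "eventually R' (nhds (0::real))" "\<And>r K. R' (r ^ (K - 1)) \<Longrightarrow> R (r, K)"
    unfolding eventually_filtercomap by auto
  from Q'(1) obtain \<delta> where \<delta>: "\<delta> > 0" "\<And>r. dist r 1 < \<delta> \<Longrightarrow> Q' r"
    by (auto simp: eventually_nhds_metric)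
  from R'(1) obtain \<epsilon> where \<epsilon>: "\<epsilon> > 0" "\<And>x. dist x 0 < \<epsilon> \<Longrightarrow> R' x"
    by (auto simp: eventually_nhds_metric)
  have "P (r, K)" if "0 < r \<and> r < 1 \<and> 1 \<le> K \<and> 1 - r < \<delta> \<and> r ^ (K - 1) < \<epsilon>" for r K
    using that by (intro QR(3) Q'(2) R'(2) \<delta>(2) \<epsilon>(2)) (auto simp: dist_real_def)
  with \<delta>(1) \<epsilon>(1) show ?R by blast
next
  assume ?R
  then obtain \<delta> \<epsilon> where *: "\<delta> > 0" "\<epsilon> > 0"
      "\<And>r K. 0 < r \<and> r < 1 \<and> 1 \<le> K \<and> 1 - r < \<delta> \<and> r ^ (K - 1) < \<epsilon> \<Longrightarrow> P (r, K)"
    by blast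
  have "eventually (\<lambda>r. dist r (1::real) < \<delta>) (nhds 1)" "eventually (\<lambda>x. dist x (0::real) < \<epsilon>) (nhds 0)"
    using *(1,2) by (auto simp: eventually_nhds_metric)
  then have "eventually (\<lambda>x. dist (case x of (r, K::nat) \<Rightarrow> r) (1::real) < \<delta>) (filtercomap (\<lambda>(r, K). r) (nhds 1))"
      "eventually (\<lambda>x. dist (case x of (r, K) \<Rightarrow> r ^ (K - 1)) (0::real) < \<epsilon>)
         (filtercomap (\<lambda>(r, K). r ^ (K - 1)) (nhds 0))"
    by (auto intro: eventually_filtercomapI)
  then have "eventually (\<lambda>(r, K). dist r (1::real) < \<delta> \<and> dist (r ^ (K - 1)) 0 < \<epsilon>)
     (inf (filtercomap (\<lambda>(r, K). r) (nhds 1)) (filtercomap (\<lambda>(r, K). r ^ (K - 1)) (nhds 0)))"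
    using eventually_conj[OF filter_leD[OF inf_le1] filter_leD[OF inf_le2]]
    by (simp add: case_prod_unfold)
  then show ?L
    unfolding regime_def eventually_inf_principal
    by (rule eventually_mono) (auto simp: dist_real_def intro!: *(3))
qed

lemma regime_neq_bot: "regime \<noteq> bot"
proof
  assume "regime = bot"
  then have "eventually (\<lambda>_. False) regime" by simp
  then obtain \<delta> \<epsilon> :: real where *: "\<delta> > 0" "\<epsilon> > 0"
      "\<And>r K. \<not> (0 < r \<and> r < 1 \<and> 1 \<le> (K::nat) \<and> 1 - r < \<delta> \<and> r ^ (K - 1) < \<epsilon>)"
    unfolding eventually_regime by blast
  define r where "r = max (1/2) (1 - \<delta> / 2)"
  have r: "0 < r" "r < 1" "1 - r < \<delta>" using *(1) by (auto simp: r_def)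
  obtain n where "r ^ n < \<epsilon>" using real_arch_pow_inv[OF *(2) r(2)] by blast
  with *(3)[of r "Suc n"] r show False by simp
qed

end

theory Submission
  imports Defs "HOL-Real_Asymp.Real_Asymp"
begin

text \<open>
  By antisymmetry only \<open>(0,1/2)\<close> matters. On a linear polynomial the supremum norm over an interval is at most
  twice the normalised \<open>L\<^sup>2\<close> norm, so the best \<open>L\<^sup>2\<close> approximation is uniformly close to every other good
  linear approximation. On \<open>I\<^sub>k\<close> with \<open>k < K\<close> the comparison is with the Taylor polynomial: Mills' ratio gives
  \<open>\<bar>(\<Phi>\<inverse>)''(u)\<bar> = O(u\<^sup>-\<^sup>2)\<close>, and \<open>I\<^sub>k\<close> has length \<open>O((1 - r) u)\<close>, so the error is \<open>O((1 - r)\<^sup>2)\<close>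
  uniformly in \<open>k\<close>. On \<open>I\<^sub>K = (0,b)\<close> the comparison is with the constant \<open>\<Phi>\<inverse>(b) = -y\<close>: again by
  Mills' ratio \<open>\<bar>\<Phi>\<inverse>(u) - \<Phi>\<inverse>(b)\<bar> \<le> ln (b/u) / y\<close>, whose \<open>p\<close>-th power has integral
  \<open>O(b y\<^sup>-\<^sup>p)\<close>, and a crude Gaussian lower tail bound gives \<open>ln (1 / (b \<surd>(2\<pi>))) \<le> 2 y\<^sup>2\<close>.
\<close>

section \<open>The Gaussian distribution function and its inverse\<close>

lemma std_normal_density_deriv:
  "(std_normal_density has_real_derivative - x * std_normal_density x) (at x)"
  unfolding std_normal_density_def[abs_def]
  by (auto intro!: derivative_eq_intros simp: field_simps power2_eq_square)

lemma std_normal_density_mono: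
  assumes "x \<le> y" "y \<le> 0"
  shows "std_normal_density x \<le> std_normal_density y"
  using assms abs_le_square_iff[of y x] by (simp add: std_normal_density_def divide_right_mono)

text \<open>The measure-theoretic \<open>cdf\<close> is turned into a gauge integral over a closed
  interval, the form to which the fundamental theorem of calculus applies; the added endpoint is
  negligible.\<close>

lemma Phi_diff:
  assumes "x < y"
  shows "Phi y - Phi x = integral {x..y} std_normal_density"
proof -
  interpret real_distribution std_normal_distribution
    by (rule real_dist_normal_dist)
  have int: "set_integrable lborel {x<..y} std_normal_density"
    unfolding set_integrable_def
    by (intro integrable_mult_indicator) (auto simp: integrable_normal_density)
  have "Phi y - Phi x = measure std_normal_distribution {x<..y}"
    unfolding Phi_def by (rule cdf_diff_eq[OF assms])
  also have "\<dots> = (\<integral>t. indicator {x<..y} t \<partial>std_normal_distribution)"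
    by simp
  also have "\<dots> = (LINT t:{x<..y}|lborel. std_normal_density t)"
    unfolding set_lebesgue_integral_def
    by (subst integral_density) (auto simp: normal_density_nonneg mult.commute)
  also have "\<dots> = integral {x<..y} std_normal_density"
    by (rule set_borel_integral_eq_integral(2)[OF int])
  also have "\<dots> = integral {x..y} std_normal_density"
    by (rule integral_subset_negligible)
       (auto intro: negligible_subset[of "{x}"])
  finally show ?thesis .
qed

lemma Phi_deriv: "(Phi has_real_derivative std_normal_density x) (at x)"
proof -
  \<comment> \<open>Starting at \<open>x - 1\<close> and ending at \<open>x + 1\<close> makes
    \<open>x\<close> an interior point, so the derivative within the interval is the full
    derivative.\<close>
  have "((\<lambda>t. integral {x - 1..t} std_normal_density) has_real_derivative std_normal_density x)
          (at x within {x - 1..x + 1})"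
    by (rule integral_has_real_derivative)
       (auto intro!: continuous_intros DERIV_continuous_on
          std_normal_density_deriv[THEN has_field_derivative_at_within])
  then have "((\<lambda>t. integral {x - 1..t} std_normal_density + Phi (x - 1)) has_real_derivative std_normal_density x)
          (at x)"
    by (auto intro!: derivative_eq_intros simp: at_within_Icc_at)
  then show ?thesis
    by (rule has_field_derivative_transform_within_open[where S="{x - 1<..<x + 1}"])
       (auto simp: Phi_diff[symmetric])
qed

lemma Phi_strict_mono: "strict_mono Phi"
proof (rule strict_monoI)
  fix x y :: real assume "x < y"
  then show "Phi x < Phi y"
    by (rule DERIV_pos_imp_increasing) (use Phi_deriv normal_density_pos[of 1 0] in force)
qed

lemma Phi_at_bot: "(Phi \<longlongrightarrow> 0) at_bot"
  unfolding Phi_def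
  by (rule finite_borel_measure.cdf_lim_at_bot)
     (use real_dist_normal_dist in \<open>simp add: real_distribution.finite_borel_measure_M\<close>)

lemma Phi_at_top: "(Phi \<longlongrightarrow> 1) at_top"
  unfolding Phi_def
  by (rule real_distribution.cdf_lim_at_top_prob[OF real_dist_normal_dist])

lemma Phi_nonneg: "0 \<le> Phi x"
  by (simp add: Phi_def cdf_def)

lemma Phi_pos: "0 < Phi x"
  using strict_monoD[OF Phi_strict_mono, of "x - 1" x] Phi_nonneg[of "x - 1"] by simp

text \<open>The density is even, so \<open>Phi x + Phi (- x)\<close> has derivative zero; its
  constant value is read off from the limit at infinity.\<close>

lemma Phi_minus: "Phi (- x) = 1 - Phi x"
proof -
  define S where "S = (\<lambda>x. Phi x + Phi (- x))"
  have "(S has_real_derivative 0) (at x)" for x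
    unfolding S_def
    by (auto intro!: derivative_eq_intros DERIV_chain2[OF Phi_deriv] Phi_deriv
        simp: std_normal_density_def)
  then have const: "S y = S 0" for y
    using DERIV_isconst_all by blast
  have "(S \<longlongrightarrow> 1 + 0) at_top"
    unfolding S_def
    by (intro tendsto_add Phi_at_top filterlim_compose[OF Phi_at_bot filterlim_uminus_at_bot_at_top])
  moreover have "(S \<longlongrightarrow> S 0) at_top"
    by (subst const[abs_def]) auto
  ultimately have "S 0 = 1"
    using tendsto_unique trivial_limit_at_top_linorder by fastforce
  with const[of x] show ?thesis
    by (simp add: S_def)
qed

lemma Phi_less_1: "Phi x < 1"
  using Phi_pos[of "- x"] by (simp add: Phi_minus)

lemma range_Phi: "range Phi = {0<..<1}"
proof (intro equalityI subsetI)
  fix u :: real assume "u \<in> {0<..<1}"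
  then have u: "0 < u" "u < 1" by auto
  obtain a where a: "Phi a < u"
    using order_tendstoD(2)[OF Phi_at_bot u(1)] by (meson eventually_at_bot_linorder order_refl)
  obtain b where b: "u < Phi b"
    using order_tendstoD(1)[OF Phi_at_top u(2)] by (meson eventually_at_top_linorder order_refl)
  have "a < b" using a b Phi_strict_mono strict_mono_less by fastforce
  then obtain x where "Phi x = u"
    using IVT[of Phi a u b] a b Phi_deriv DERIV_isCont by (metis less_imp_le)
  then show "u \<in> range Phi" by auto
qed (auto simp: Phi_pos Phi_less_1)

lemma Phi_inv_Phi [simp]: "Phi_inv (Phi x) = x"
  unfolding Phi_inv_def using Phi_strict_mono by (simp add: strict_mono_imp_inj_on)

lemma Phi_Phi_inv: "u \<in> {0<..<1} \<Longrightarrow> Phi (Phi_inv u) = u"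
  unfolding Phi_inv_def using range_Phi by (simp add: f_inv_into_f)

lemma Phi_inv_mono: "0 < u \<Longrightarrow> u \<le> v \<Longrightarrow> v < 1 \<Longrightarrow> Phi_inv u \<le> Phi_inv v"
  using strict_mono_less_eq[OF Phi_strict_mono, of "Phi_inv u" "Phi_inv v"] by (simp add: Phi_Phi_inv)

lemma Phi_inv_symmetric: "u \<in> {0<..<1} \<Longrightarrow> Phi_inv (1 - u) = - Phi_inv u"
  by (metis Phi_Phi_inv Phi_inv_Phi Phi_minus)

lemma Phi_inv_half [simp]: "Phi_inv (1 / 2) = 0"
  using Phi_inv_symmetric[of "1/2"] by simp

section \<open>Derivatives of the quantile function and Gaussian tail bounds\<close>

lemma Phi_inv_deriv:
  assumes "u \<in> {0<..<1}"
  shows "(Phi_inv has_real_derivative 1 / std_normal_density (Phi_inv u)) (at u)"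
proof -
  have "isCont Phi_inv (Phi (Phi_inv u))"
    by (rule isCont_inverse_function2[of "Phi_inv u - 1" _ "Phi_inv u + 1"])
       (auto intro: DERIV_isCont Phi_deriv)
  then have "isCont Phi_inv u"
    using assms by (simp add: Phi_Phi_inv)
  then show ?thesis
    using DERIV_inverse_function[OF Phi_deriv, of Phi_inv u 0 1] assms
    by (simp add: Phi_Phi_inv inverse_eq_divide less_imp_neq[OF normal_density_pos, symmetric])
qed

text \<open>The density phi satisfies phi'(x) = - x phi(x), so 1/phi has derivative x/phi(x); the
  chain rule through \<open>Phi_inv\<close> adds another factor 1/phi.\<close>

lemma Phi_inv_second_deriv:
  assumes "u \<in> {0<..<1}"
  shows "((\<lambda>u. 1 / std_normal_density (Phi_inv u)) has_real_derivative
           Phi_inv u / (std_normal_density (Phi_inv u))\<^sup>2) (at u)"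
proof -
  have "std_normal_density (Phi_inv u) \<noteq> 0"
    by (simp add: less_imp_neq[OF normal_density_pos, symmetric])
  then show ?thesis
    by (auto intro!: derivative_eq_intros DERIV_chain2[OF std_normal_density_deriv Phi_inv_deriv[OF assms]]
        simp: field_simps power2_eq_square)
qed

text \<open>Mills' ratio; only the sign of \<open>(x - t) \<phi>(t)\<close>, the derivative of \<open>\<phi>(t) + x \<Phi>(t)\<close> for \<open>t \<le> x\<close>, is used.\<close>

lemma Phi_Mills: "- x * Phi x \<le> std_normal_density x"
proof -
  define h where "h = (\<lambda>t. std_normal_density t + x * Phi t)"
  have der: "(h has_real_derivative (x - t) * std_normal_density t) (at t)" for t
    unfolding h_def
    by (auto intro!: derivative_eq_intros std_normal_density_deriv Phi_deriv simp: algebra_simps)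
  have "x * Phi y \<le> h x" if "y \<le> x" for y
  proof -
    have "h y \<le> h x"
      by (rule DERIV_nonneg_imp_nondecreasing[OF that])
         (use der in \<open>fastforce intro: mult_nonneg_nonneg\<close>)
    \<comment> \<open>The density at \<open>y\<close> is nonnegative and is dropped, so that letting
      \<open>y\<close> tend to minus infinity needs only the limit of \<open>Phi\<close>.\<close>
    then show ?thesis by (simp add: h_def) (smt (verit) normal_density_nonneg)
  qed
  then have "eventually (\<lambda>y. x * Phi y \<le> h x) at_bot"
    using eventually_at_bot_linorder by blast
  moreover have "((\<lambda>y. x * Phi y) \<longlongrightarrow> x * 0) at_bot"
    by (intro tendsto_intros Phi_at_bot)
  ultimately have "x * 0 \<le> h x"
    by (intro tendsto_upperbound) auto
  then show ?thesis by (simp add: h_def)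
qed

text \<open>Mills' ratio says little near \<open>x = 0\<close>, where its factor \<open>- x\<close>
  vanishes. For \<open>x \<le> - 1\<close> that factor is at least the constant used here, and on
  the remaining bounded range monotonicity of the density and \<open>Phi x < 1\<close>
  suffice.\<close>

lemma Phi_le_density:
  assumes "x \<le> 0"
  shows "std_normal_density (- 1) * Phi x \<le> std_normal_density x"
proof (cases "x \<le> - 1")
  case True
  have "sqrt (2 * pi) \<ge> 1"
    using pi_ge_two by (intro real_sqrt_ge_one) linarith
  moreover have "exp (- 1 / 2 :: real) \<le> 1"
    by simp
  ultimately have "exp (- 1 / 2 :: real) \<le> sqrt (2 * pi)"
    by linarith
  then have "std_normal_density (- 1) \<le> 1"
    by (simp add: std_normal_density_def)
  then have "std_normal_density (- 1) * Phi x \<le> - x * Phi x"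
    using True Phi_nonneg[of x] by (intro mult_right_mono) auto
  with Phi_Mills show ?thesis by (rule order_trans[rotated])
next
  case False
  then have "std_normal_density (- 1) \<le> std_normal_density x"
    using assms by (intro std_normal_density_mono) auto
  moreover have "std_normal_density (- 1) * Phi x \<le> std_normal_density (- 1) * 1"
    using Phi_less_1[of x] by (intro mult_left_mono) (auto simp: less_imp_le)
  ultimately show ?thesis by simp
qed

text \<open>Two lower bounds for the density are multiplied: Mills' ratio absorbs the factor
  \<open>x\<close> together with one power of \<open>u\<close>, and \<open>Phi_le_density\<close>
  supplies the other power.\<close>

lemma Phi_inv_second_deriv_bound:
  assumes "0 < u" "u \<le> 1 / 2"
  defines "x \<equiv> Phi_inv u"
  shows "\<bar>x / (std_normal_density x)\<^sup>2\<bar> \<le> 1 / (std_normal_density (- 1) * u\<^sup>2)"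
proof -
  define d where "d = std_normal_density x"
  define c where "c = std_normal_density (- 1)"
  have pos: "d > 0" "c > 0" unfolding d_def c_def by (simp_all add: normal_density_pos)
  have x: "x \<le> 0" "Phi x = u"
    using Phi_inv_mono[of u "1/2"] assms by (simp_all add: Phi_Phi_inv)
  have 1: "- x * u \<le> d" "c * u \<le> d"
    using Phi_Mills[of x] Phi_le_density[of x] x by (auto simp: d_def c_def)
  have "(- x * u) * (c * u) \<le> d * d"
    using 1 x(1) assms(1) pos by (intro mult_mono) (auto intro: mult_nonpos_nonneg)
  then show ?thesis
    using pos x assms(1) unfolding d_def[symmetric] c_def[symmetric]
    by (simp add: abs_div divide_simps power2_eq_square mult_ac)
qed

text \<open>The mean value theorem on the unit interval ending at \<open>- y\<close> bounds the tail
  below by the density at the left end. The loss is harmless, since only the order of the exponent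
  matters after taking logarithms.\<close>

lemma Phi_lower_bound:
  assumes "0 \<le> y"
  shows "std_normal_density (y + 1) \<le> Phi (- y)"
proof -
  obtain z where z: "- y - 1 < z" "z < - y" "Phi (- y) - Phi (- y - 1) = (- y - (- y - 1)) * std_normal_density z"
    using MVT2[of "- y - 1" "- y" Phi std_normal_density] Phi_deriv by auto
  have "std_normal_density (y + 1) = std_normal_density (- y - 1)"
    by (simp add: std_normal_density_def power2_eq_square algebra_simps)
  also have "\<dots> \<le> std_normal_density z"
    using z assms by (intro std_normal_density_mono) auto
  also have "\<dots> \<le> Phi (- y)"
    using z(3) Phi_nonneg[of "- y - 1"] by simp
  finally show ?thesis .
qed

section \<open>Best linear approximation in the mean\<close>

text \<open>The centre \<open>m\<close> is left free so that it can be the midpoint of an interval,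
  where the constant and the linear part are orthogonal.\<close>

lemma poly_degree_le_1:
  fixes q :: "real poly"
  assumes "degree q \<le> 1"
  obtains c d where "\<And>u. poly q u = c + d * (u - m)"
proof -
  obtain a q' where q: "q = pCons a q'"
    by (cases q)
  then have "degree q' = 0"
    using assms by (auto simp: degree_pCons_eq_if split: if_splits)
  then obtain d where "q' = [:d:]"
    by (rule degree_eq_zeroE)
  then have "poly q u = (a + d * m) + d * (u - m)" for u
    by (simp add: q algebra_simps)
  then show ?thesis
    by (rule that)
qed

text \<open>Leaving the endpoints open to choice covers both the half-open intervals with
  \<open>k < K\<close> and the open last one; integrals agree with those over \<open>{a..b}\<close>
  because endpoints are null.\<close>

locale bounded_interval =
  fixes a b :: real and I :: "real set"
  assumes less: "a < b" and I_sets [measurable]: "I \<in> sets borel"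
    and I_lower: "{a<..<b} \<subseteq> I" and I_upper: "I \<subseteq> {a..b}"
begin

lemma FTC:
  fixes F g :: "real \<Rightarrow> real"
  assumes "\<And>x. (F has_real_derivative g x) (at x)" "\<And>x. isCont g x"
  shows "set_integrable lborel I g" "(LINT u:I|lborel. g u) = F b - F a"
proof -
  have [measurable]: "g \<in> borel_measurable borel"
    using assms(2) by (intro borel_measurable_continuous_onI continuous_at_imp_continuous_on) auto
  have "has_bochner_integral lborel (\<lambda>x. g x * indicator {a..b} x) (F b - F a)"
    by (intro has_bochner_integral_FTC_Icc_real assms) (use less in auto)
  then have Icc: "set_integrable lborel {a..b} g" "(LINT u:{a..b}|lborel. g u) = F b - F a"
    by (auto simp: set_integrable_def set_lebesgue_integral_def has_bochner_integral_iff mult.commute)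
  show "set_integrable lborel I g"
    by (rule set_integrable_subset[OF Icc(1)]) (use I_upper in auto)
  have "AE u in lborel. u \<in> {a..b} \<longleftrightarrow> u \<in> I"
    using AE_lborel_singleton[of a] AE_lborel_singleton[of b]
    by eventually_elim (use I_lower I_upper in fastforce)
  then have "(LINT u:I|lborel. g u) = (LINT u:{a..b}|lborel. g u)"
    by (intro set_integral_cong_set) (auto simp: set_borel_measurable_def)
  then show "(LINT u:I|lborel. g u) = F b - F a"
    using Icc(2) by simp
qed

lemma integral_const:
  fixes c :: real
  shows "set_integrable lborel I (\<lambda>u. c)" "(LINT u:I|lborel. c) = (b - a) * c"
proof -
  have der: "((\<lambda>x. c * x) has_real_derivative c) (at x)" for x
    by (auto intro!: derivative_eq_intros)
  show "set_integrable lborel I (\<lambda>u. c)" "(LINT u:I|lborel. c) = (b - a) * c"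
    using FTC[OF der continuous_const] by (simp_all add: algebra_simps)
qed

lemma integral_linear_square:
  fixes c d :: real
  defines "m \<equiv> (a + b) / 2"
  shows "set_integrable lborel I (\<lambda>u. (c + d * (u - m))\<^sup>2)"
    and "(LINT u:I|lborel. (c + d * (u - m))\<^sup>2) = (b - a) * c\<^sup>2 + (b - a) ^ 3 / 12 * d\<^sup>2"
proof -
  define F where "F x = c\<^sup>2 * (x - m) + c * d * (x - m)\<^sup>2 + d\<^sup>2 * (x - m) ^ 3 / 3" for x
  have "(F has_real_derivative (c + d * (x - m))\<^sup>2) (at x)" for x
    unfolding F_def by (auto intro!: derivative_eq_intros simp: power2_eq_square field_simps)
  note * = FTC[OF this]
  show "set_integrable lborel I (\<lambda>u. (c + d * (u - m))\<^sup>2)"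
    by (rule *) auto
  have bm: "b - m = (b - a) / 2" and am: "a - m = - ((b - a) / 2)"
    by (auto simp: m_def field_simps)
  have "F b - F a = (b - a) * c\<^sup>2 + (b - a) ^ 3 / 12 * d\<^sup>2"
    unfolding F_def bm am by (simp add: power3_eq_cube power2_eq_square field_simps)
  then show "(LINT u:I|lborel. (c + d * (u - m))\<^sup>2) = (b - a) * c\<^sup>2 + (b - a) ^ 3 / 12 * d\<^sup>2"
    by (subst *) auto
qed

lemma poly_square_integrable:
  fixes q :: "real poly"
  assumes "degree q \<le> 1"
  shows "set_integrable lborel I (\<lambda>u. (poly q u)\<^sup>2)"
proof -
  obtain c d where "\<And>u. poly q u = c + d * (u - (a + b) / 2)"
    using poly_degree_le_1[OF assms] by metis
  then show ?thesis
    using integral_linear_square(1) by simp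
qed

text \<open>After centring at the midpoint the integral is a weighted sum of
  \<open>c\<^sup>2\<close> and \<open>d\<^sup>2\<close>, while on the interval the linear part is at
  most half the length times the slope.\<close>

lemma poly_square_le_integral:
  fixes q :: "real poly"
  assumes "degree q \<le> 1" "u \<in> {a..b}"
  shows "(poly q u)\<^sup>2 \<le> 4 / (b - a) * (LINT u:I|lborel. (poly q u)\<^sup>2)"
proof -
  define h where "h = b - a"
  have h: "h > 0" using less by (simp add: h_def)
  obtain c d where q: "\<And>u. poly q u = c + d * (u - (a + b) / 2)"
    using poly_degree_le_1[OF assms(1)] by metis
  define t where "t = d * (u - (a + b) / 2)"
  have "\<bar>u - (a + b) / 2\<bar> \<le> h / 2"
    using assms(2) by (auto simp: h_def abs_if field_simps)
  then have "(u - (a + b) / 2)\<^sup>2 \<le> (h / 2)\<^sup>2"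
    using h by (intro abs_le_square_iff[THEN iffD1]) auto
  then have "d\<^sup>2 * (u - (a + b) / 2)\<^sup>2 \<le> d\<^sup>2 * (h / 2)\<^sup>2"
    by (rule mult_left_mono) auto
  then have t: "t\<^sup>2 \<le> d\<^sup>2 * h\<^sup>2 / 4"
    by (simp add: t_def power_mult_distrib power_divide)
  \<comment> \<open>The weights are chosen so that, after
    \<open>t\<^sup>2 \<le> d\<^sup>2 * h\<^sup>2 / 4\<close>, the bound is exactly proportional to
    the integral in \<open>integral_linear_square\<close>.\<close>
  have "0 \<le> 3 * (c - t / 3)\<^sup>2"
    by simp
  then have "(c + t)\<^sup>2 \<le> 4 * c\<^sup>2 + 4 / 3 * t\<^sup>2"
    by (simp add: power2_eq_square algebra_simps)
  also have "\<dots> \<le> 4 * c\<^sup>2 + d\<^sup>2 * h\<^sup>2 / 3"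
    using t by simp
  also have "\<dots> = 4 / h * (h * c\<^sup>2 + h ^ 3 / 12 * d\<^sup>2)"
    using h by (simp add: field_simps power2_eq_square power3_eq_cube)
  finally show ?thesis
    unfolding q t_def integral_linear_square(2) h_def .
qed

lemma continuous_square_integrable:
  fixes f :: "real \<Rightarrow> real"
  assumes "continuous_on {a..b} f"
  shows "set_integrable lborel I (\<lambda>u. (f u)\<^sup>2)"
  by (rule set_integrable_subset[OF borel_integrable_atLeastAtMost'])
     (use assms I_upper in \<open>auto intro!: continuous_intros\<close>)

lemma sub_poly_square_integrable:
  assumes "set_borel_measurable lborel I f" "set_integrable lborel I (\<lambda>u. (f u)\<^sup>2)" "degree q \<le> 1"
  shows "set_integrable lborel I (\<lambda>u. (f u - poly q u)\<^sup>2)"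
proof (rule set_integrable_bound)
  show "set_integrable lborel I (\<lambda>u. 2 * (f u)\<^sup>2 + 2 * (poly q u)\<^sup>2)"
    using assms poly_square_integrable by (intro set_integral_add) auto
  have [measurable]: "poly q \<in> borel_measurable borel"
    by (intro borel_measurable_continuous_onI continuous_intros)
  have [measurable]: "(\<lambda>u. indicator I u * f u) \<in> borel_measurable borel"
    using assms(1) by (simp add: set_borel_measurable_def)
  \<comment> \<open>\<open>f\<close> is known to be measurable only after cutting off to
    \<open>I\<close>, so the indicator is moved inside the square.\<close>
  have "(\<lambda>u. indicator I u * (f u - poly q u)\<^sup>2) = (\<lambda>u. (indicator I u * f u - indicator I u * poly q u)\<^sup>2)"
    by (auto simp: indicator_def)
  then show "set_borel_measurable lborel I (\<lambda>u. (f u - poly q u)\<^sup>2)"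
    by (simp add: set_borel_measurable_def)
  have "norm ((f u - poly q u)\<^sup>2) \<le> norm (2 * (f u)\<^sup>2 + 2 * (poly q u)\<^sup>2)" for u
  proof -
    have "(f u - poly q u)\<^sup>2 \<le> 2 * (f u)\<^sup>2 + 2 * (poly q u)\<^sup>2"
      using zero_le_power2[of "f u + poly q u"] by (simp add: power2_eq_square algebra_simps)
    then show ?thesis
      by simp
  qed
  then show "AE u in lborel. u \<in> I \<longrightarrow> norm ((f u - poly q u)\<^sup>2) \<le> norm (2 * (f u)\<^sup>2 + 2 * (poly q u)\<^sup>2)"
    by simp
qed

text \<open>In coordinates centred at the midpoint the objective is a quadratic in \<open>c\<close>
  and \<open>d\<close> without a mixed term, so completing two squares exhibits a minimiser.\<close>

lemma best_linear_exists:
  assumes f: "set_borel_measurable lborel I f" "set_integrable lborel I (\<lambda>u. (f u)\<^sup>2)"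
  shows "\<exists>q. is_arg_min (\<lambda>q. LINT u:I|lborel. \<bar>f u - poly q u\<bar>\<^sup>2) (\<lambda>q. degree q \<le> 1) q"
proof -
  define m where "m = (a + b) / 2"
  define A where "A = (LINT u:I|lborel. (f u)\<^sup>2)"
  define B where "B = (LINT u:I|lborel. f u)"
  define C where "C = (LINT u:I|lborel. f u * (u - m))"
  define h where "h = b - a"
  define s where "s = h ^ 3 / 12"
  have pos: "h > 0" "s > 0"
    using less by (auto simp: h_def s_def)
  \<comment> \<open>Polarisation writes the product through three integrable squares; the choices 1
    and \<open>u - m\<close> then give the moments \<open>B\<close> and \<open>C\<close>.\<close>
  have prod: "set_integrable lborel I (\<lambda>u. f u * poly q u)" if q: "degree q \<le> 1" for q :: "real poly"
  proof -
    have "set_integrable lborel I (\<lambda>u. ((f u)\<^sup>2 + (poly q u)\<^sup>2 - (f u - poly q u)\<^sup>2) / 2)"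
      using f poly_square_integrable[OF q] sub_poly_square_integrable[OF f q]
      by (intro set_integrable_divide set_integral_diff(1) set_integral_add(1))
    then show ?thesis
      by (simp add: power2_eq_square algebra_simps)
  qed
  have f1: "set_integrable lborel I f" and f2: "set_integrable lborel I (\<lambda>u. f u * (u - m))"
    using prod[of "1"] prod[of "[:- m, 1:]"] by (simp_all add: algebra_simps)
  have val: "(LINT u:I|lborel. \<bar>f u - poly q u\<bar>\<^sup>2) = A - 2 * c * B - 2 * d * C + h * c\<^sup>2 + s * d\<^sup>2"
    if q: "\<And>u. poly q u = c + d * (u - m)" for q :: "real poly" and c d
  proof -
    have "(LINT u:I|lborel. \<bar>f u - poly q u\<bar>\<^sup>2)
       = (LINT u:I|lborel. (f u)\<^sup>2 - 2 * c * f u - 2 * d * (f u * (u - m)) + (c + d * (u - m))\<^sup>2)"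
      by (intro set_lebesgue_integral_cong) (auto simp: q power2_eq_square algebra_simps)
    also have "\<dots> = A - 2 * c * B - 2 * d * C + (LINT u:I|lborel. (c + d * (u - m))\<^sup>2)"
      using f(2) f1 f2 integral_linear_square(1)[of c d]
      by (simp add: set_integral_add set_integral_diff A_def B_def C_def m_def)
    finally show ?thesis
      by (simp add: integral_linear_square(2) m_def h_def s_def)
  qed
  \<comment> \<open>The stationary point is \<open>c = B / h\<close>, \<open>d = C / s\<close>, here
    re-expanded in powers of \<open>u\<close>.\<close>
  define q0 :: "real poly" where "q0 = [:B / h - C / s * m, C / s:]"
  have deg: "degree q0 \<le> 1"
    by (simp add: q0_def)
  have "(LINT u:I|lborel. \<bar>f u - poly q0 u\<bar>\<^sup>2) \<le> (LINT u:I|lborel. \<bar>f u - poly q u\<bar>\<^sup>2)"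
    if deg_q: "degree q \<le> 1" for q
  proof -
    obtain c d where q: "\<And>u. poly q u = c + d * (u - m)"
      using poly_degree_le_1[OF deg_q] by metis
    have "(LINT u:I|lborel. \<bar>f u - poly q0 u\<bar>\<^sup>2)
        = A - 2 * (B / h) * B - 2 * (C / s) * C + h * (B / h)\<^sup>2 + s * (C / s)\<^sup>2"
      by (rule val) (simp add: q0_def algebra_simps diff_divide_distrib)
    also have "\<dots> = (A - 2 * c * B - 2 * d * C + h * c\<^sup>2 + s * d\<^sup>2) - h * (c - B / h)\<^sup>2 - s * (d - C / s)\<^sup>2"
      using pos by (simp add: power2_eq_square field_simps)
    also have "\<dots> \<le> (LINT u:I|lborel. \<bar>f u - poly q u\<bar>\<^sup>2)"
      unfolding val[OF q] using pos zero_le_power2[of "c - B / h"] zero_le_power2[of "d - C / s"]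
      by (smt (verit) mult_nonneg_nonneg)
    finally show ?thesis .
  qed
  with deg show ?thesis
    unfolding is_arg_min_linorder by blast
qed

text \<open>By minimality both \<open>D\<close> and \<open>T\<close> are close to \<open>f\<close>
  in the mean, hence to each other; their difference is linear, so
  \<open>poly_square_le_integral\<close> makes this uniform. The 16 is 4 from that lemma times 4
  from the triangle inequality for squares.\<close>

lemma best_linear_near:
  assumes f: "set_borel_measurable lborel I f" "set_integrable lborel I (\<lambda>u. (f u)\<^sup>2)"
    and D: "is_arg_min (\<lambda>q. LINT u:I|lborel. \<bar>f u - poly q u\<bar>\<^sup>2) (\<lambda>q. degree q \<le> 1) D"
    and T: "degree T \<le> 1" and u: "u \<in> {a..b}"
  shows "(poly D u - poly T u)\<^sup>2 \<le> 16 / (b - a) * (LINT u:I|lborel. (f u - poly T u)\<^sup>2)"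
proof -
  have D1: "degree D \<le> 1" and min: "(LINT u:I|lborel. (f u - poly D u)\<^sup>2) \<le> (LINT u:I|lborel. (f u - poly T u)\<^sup>2)"
    using D T by (auto simp: is_arg_min_linorder)
  have deg: "degree (D - T) \<le> 1"
    using D1 T by (intro degree_diff_le) auto
  note int = sub_poly_square_integrable[OF f D1] sub_poly_square_integrable[OF f T]
  have "(LINT u:I|lborel. (poly (D - T) u)\<^sup>2) \<le> (LINT u:I|lborel. 2 * (f u - poly D u)\<^sup>2 + 2 * (f u - poly T u)\<^sup>2)"
  proof (rule set_integral_mono)
    show "(poly (D - T) u)\<^sup>2 \<le> 2 * (f u - poly D u)\<^sup>2 + 2 * (f u - poly T u)\<^sup>2" for u
      using zero_le_power2[of "(f u - poly D u) + (f u - poly T u)"] by (simp add: power2_eq_square algebra_simps)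
  qed (use int poly_square_integrable[OF deg] in \<open>auto intro!: set_integral_add(1)\<close>)
  also have "\<dots> \<le> 4 * (LINT u:I|lborel. (f u - poly T u)\<^sup>2)"
    using int min by (simp add: set_integral_add)
  finally have "4 / (b - a) * (LINT u:I|lborel. (poly (D - T) u)\<^sup>2) \<le> 4 / (b - a) * (4 * (LINT u:I|lborel. (f u - poly T u)\<^sup>2))"
    using less by (intro mult_left_mono) auto
  with poly_square_le_integral[OF deg u] show ?thesis
    by simp
qed

end

section \<open>The error on the individual intervals\<close>

lemma continuous_on_Phi_inv: "continuous_on {0<..<1} Phi_inv"
  using DERIV_isCont[OF Phi_inv_deriv] by (intro continuous_at_imp_continuous_on) auto

lemma Phi_inv_measurable:
  assumes "A \<in> sets borel" "A \<subseteq> {0<..<1}"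
  shows "set_borel_measurable lborel A Phi_inv"
proof (rule set_borel_measurable_subset)
  show "set_borel_measurable lborel {0<..<1} Phi_inv"
    using borel_measurable_continuous_on_indicator[OF _ continuous_on_Phi_inv]
    by (simp add: set_borel_measurable_def)
qed (use assms in auto)

lemma linear_error_measurable:
  assumes A: "A \<in> sets borel" "A \<subseteq> {0<..<1}" and "0 < p"
  shows "set_borel_measurable lborel A (\<lambda>u. \<bar>poly q u - Phi_inv u\<bar> powr p)"
proof -
  have [measurable]: "A \<in> sets borel" "poly q \<in> borel_measurable borel"
    using A(1) by (auto intro!: borel_measurable_continuous_onI continuous_intros)
  have [measurable]: "(\<lambda>u. indicator A u * Phi_inv u) \<in> borel_measurable borel"
    using Phi_inv_measurable[OF A] by (simp add: set_borel_measurable_def)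
  \<comment> \<open>Since \<open>0 powr p = 0\<close>, the indicator can be moved inside, where it
    makes \<open>Phi_inv\<close> measurable.\<close>
  have eq: "(\<lambda>u. indicator A u * \<bar>poly q u - Phi_inv u\<bar> powr p)
      = (\<lambda>u. \<bar>indicator A u * poly q u - indicator A u * Phi_inv u\<bar> powr p)"
    using \<open>0 < p\<close> by (auto simp: indicator_def)
  show ?thesis
    unfolding set_borel_measurable_def real_scaleR_def eq by measurable
qed

text \<open>\<open>best_linear\<close> is a Hilbert choice, so it has the minimising property only
  once some minimiser is known to exist.\<close>

lemma best_linear_is_arg_min:
  assumes "bounded_interval a b (geometric_interval r K k)"
    and "set_borel_measurable lborel (geometric_interval r K k) Phi_inv"
    and "set_integrable lborel (geometric_interval r K k) (\<lambda>u. (Phi_inv u)\<^sup>2)"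
  shows "is_arg_min (\<lambda>q. LINT u:geometric_interval r K k|lborel. \<bar>Phi_inv u - poly q u\<bar>\<^sup>2)
           (\<lambda>q. degree q \<le> 1) (best_linear r K k)"
  using bounded_interval.best_linear_exists[OF assms]
  unfolding best_linear_def arg_min_def by (rule someI_ex)

section \<open>The intervals away from the singularity\<close>

text \<open>The expansion is at the left endpoint, where the bound of order
  \<open>1 / u\<^sup>2\<close> for the second derivative is largest.\<close>

lemma Phi_inv_Taylor:
  assumes "0 < a" "a \<le> u" "u \<le> b" "b \<le> 1 / 2"
  shows "\<bar>Phi_inv u - (Phi_inv a + 1 / std_normal_density (Phi_inv a) * (u - a))\<bar>
           \<le> (b - a)\<^sup>2 / (2 * std_normal_density (- 1) * a\<^sup>2)"
proof (cases "u = a")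
  case True
  then show ?thesis by (simp add: normal_density_nonneg)
next
  case False
  define f1 where "f1 = (\<lambda>u. 1 / std_normal_density (Phi_inv u))"
  define f2 where "f2 = (\<lambda>u. Phi_inv u / (std_normal_density (Phi_inv u))\<^sup>2)"
  define diff where "diff = (\<lambda>m::nat. if m = 0 then Phi_inv else if m = 1 then f1 else f2)"
  have deriv: "\<forall>m t. m < 2 \<and> a \<le> t \<and> t \<le> b \<longrightarrow> DERIV (diff m) t :> diff (Suc m) t"
  proof (intro allI impI)
    fix m :: nat and t assume t: "m < 2 \<and> a \<le> t \<and> t \<le> b"
    then have "t \<in> {0<..<1}" and "m = 0 \<or> m = 1"
      using assms by auto
    then show "DERIV (diff m) t :> diff (Suc m) t"
      using Phi_inv_deriv[of t] Phi_inv_second_deriv[of t] by (auto simp: diff_def f1_def f2_def)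
  qed
  have "\<exists>t. (if u < a then u < t \<and> t < a else a < t \<and> t < u) \<and>
      Phi_inv u = (\<Sum>m<2. (diff m a / fact m) * (u - a)^m) + (diff 2 t / fact 2) * (u - a)^2"
    by (rule Taylor[OF _ _ deriv]) (use assms False in \<open>auto simp: diff_def\<close>)
  then obtain t where t: "a < t" "t < u" and eq: "Phi_inv u = Phi_inv a + f1 a * (u - a) + f2 t / 2 * (u - a)\<^sup>2"
    using False assms by (auto simp: diff_def numeral_2_eq_2)
  define c where "c = std_normal_density (- 1)"
  have c: "c > 0" by (simp add: c_def normal_density_pos)
  have "\<bar>f2 t\<bar> \<le> 1 / (c * t\<^sup>2)"
    using Phi_inv_second_deriv_bound[of t] assms t by (simp add: f2_def c_def)
  also have "\<dots> \<le> 1 / (c * a\<^sup>2)"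
    using c t assms by (intro divide_left_mono mult_left_mono power_mono) auto
  finally have "\<bar>f2 t\<bar> * (u - a)\<^sup>2 \<le> 1 / (c * a\<^sup>2) * (b - a)\<^sup>2"
    using assms c by (intro mult_mono power_mono) auto
  then show ?thesis
    unfolding eq c_def[symmetric] f1_def by (simp add: abs_mult)
qed

text \<open>The bound is free of \<open>k\<close> by scaling: \<open>b - a = (1 - r) * b\<close> and
  \<open>a = r * b\<close>, so \<open>b\<close> cancels from the Taylor remainder.\<close>

lemma best_linear_middle:
  assumes r: "1 / 2 \<le> r" "r < 1" and k: "1 \<le> k" "k < K" and u: "u \<in> geometric_interval r K k"
  shows "\<bar>poly (best_linear r K k) u - Phi_inv u\<bar> \<le> 10 / std_normal_density (- 1) * (1 - r)\<^sup>2"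
proof -
  define c where "c = std_normal_density (- 1)"
  define b where "b = r ^ (k - 1) / 2"
  define a where "a = r * b"
  \<comment> \<open>\<open>E\<close> is the Taylor bound after \<open>r \<ge> 1 / 2\<close>. The
    best approximation lies within \<open>4 * E\<close> of the Taylor polynomial, so the total is
    \<open>5 * E\<close>, which explains the 10.\<close>
  define E where "E = 2 / c * (1 - r)\<^sup>2"
  have c: "c > 0" by (simp add: c_def normal_density_pos)
  have E: "E \<ge> 0" using c by (simp add: E_def)
  have "r * r ^ (k - 1) = r ^ k"
    using k by (simp add: power_eq_if)
  then have I: "geometric_interval r K k = {a..<b}"
    using k by (simp add: geometric_interval_def a_def b_def)
  have "r ^ (k - 1) \<le> 1"
    using r by (intro power_le_one) auto
  then have b: "0 < b" "b \<le> 1 / 2"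
    using r by (auto simp: b_def)
  have a: "0 < a" "a < b"
    using b r by (auto simp: a_def)
  interpret bounded_interval a b "geometric_interval r K k"
    by unfold_locales (use a in \<open>auto simp: I\<close>)
  have meas: "set_borel_measurable lborel (geometric_interval r K k) Phi_inv"
    by (rule Phi_inv_measurable) (use a b in \<open>auto simp: I\<close>)
  have int: "set_integrable lborel (geometric_interval r K k) (\<lambda>u. (Phi_inv u)\<^sup>2)"
    by (intro continuous_square_integrable continuous_on_subset[OF continuous_on_Phi_inv]) (use a b in auto)
  have min: "is_arg_min (\<lambda>q. LINT u:geometric_interval r K k|lborel. \<bar>Phi_inv u - poly q u\<bar>\<^sup>2)
           (\<lambda>q. degree q \<le> 1) (best_linear r K k)"
    by (rule best_linear_is_arg_min[OF bounded_interval_axioms meas int])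
  define s where "s = 1 / std_normal_density (Phi_inv a)"
  define T where "T = [:Phi_inv a - s * a, s:]"
  have T: "degree T \<le> 1" by (simp add: T_def)
  have poly_T: "poly T u = Phi_inv a + s * (u - a)" for u
    by (simp add: T_def algebra_simps)
  have near: "\<bar>Phi_inv u - poly T u\<bar> \<le> E" if "u \<in> {a..b}" for u
  proof -
    have "\<bar>Phi_inv u - poly T u\<bar> \<le> (b - a)\<^sup>2 / (2 * c * a\<^sup>2)"
      using Phi_inv_Taylor[of a u b] that a b by (simp add: poly_T s_def c_def)
    also have "\<dots> = (1 - r)\<^sup>2 / (2 * c * r\<^sup>2)"
      using b r c by (simp add: a_def power2_eq_square field_simps)
    also have "\<dots> \<le> (1 - r)\<^sup>2 / (2 * c * (1 / 2)\<^sup>2)"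
      using r c by (intro divide_left_mono mult_left_mono power_mono) auto
    also have "\<dots> = E"
      using c by (simp add: E_def power2_eq_square)
    finally show ?thesis .
  qed
  have "(LINT u:geometric_interval r K k|lborel. (Phi_inv u - poly T u)\<^sup>2)
          \<le> (LINT u:geometric_interval r K k|lborel. E\<^sup>2)"
  proof (rule set_integral_mono)
    show "(Phi_inv u - poly T u)\<^sup>2 \<le> E\<^sup>2" if "u \<in> geometric_interval r K k" for u
      using near[of u] that E I by (intro abs_le_square_iff[THEN iffD1]) auto
    show "set_integrable lborel (geometric_interval r K k) (\<lambda>u. E\<^sup>2)"
      by (rule integral_const(1))
  qed (rule sub_poly_square_integrable[OF meas int T])
  also have "\<dots> = (b - a) * E\<^sup>2"
    by (rule integral_const(2))
  finally have "16 / (b - a) * (LINT u:geometric_interval r K k|lborel. (Phi_inv u - poly T u)\<^sup>2)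
      \<le> 16 / (b - a) * ((b - a) * E\<^sup>2)"
    using a by (intro mult_left_mono) auto
  also have "\<dots> = (4 * E)\<^sup>2"
    using a by (simp add: power_mult_distrib)
  finally have "(poly (best_linear r K k) u - poly T u)\<^sup>2 \<le> (4 * E)\<^sup>2"
    using best_linear_near[OF meas int min T, of u] u I by simp
  then have "\<bar>poly (best_linear r K k) u - poly T u\<bar> \<le> 4 * E"
    using E abs_le_square_iff[of _ "4 * E"] by simp
  then have "\<bar>poly (best_linear r K k) u - Phi_inv u\<bar> \<le> 5 * E"
    using near[of u] u I by auto
  then show ?thesis by (simp add: E_def c_def)
qed

section \<open>The interval at the singularity\<close>

text \<open>This function is the integrable majorant for powers of the tail error. It is unbounded
  at 0, hence the improper form of the fundamental theorem, with limits of the antiderivative at the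
  endpoints.\<close>

lemma sqrt_singularity_integral:
  assumes "0 < b"
  shows "set_integrable lborel {0<..<b} (\<lambda>u. sqrt (b / u))" "(LINT u:{0<..<b}|lborel. sqrt (b / u)) = 2 * b"
proof -
  define F where "F u = 2 * sqrt b * sqrt u" for u
  have lim: "((F \<circ> real_of_ereal) \<longlongrightarrow> 0) (at_right (ereal 0))"
       "((F \<circ> real_of_ereal) \<longlongrightarrow> 2 * b) (at_left (ereal b))"
  proof -
    have "(F \<longlongrightarrow> F 0) (at_right 0)" "(F \<longlongrightarrow> F b) (at_left b)"
      unfolding F_def by (intro tendsto_intros)+
    then show "((F \<circ> real_of_ereal) \<longlongrightarrow> 0) (at_right (ereal 0))"
       "((F \<circ> real_of_ereal) \<longlongrightarrow> 2 * b) (at_left (ereal b))"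
      unfolding ereal_tendsto_simps using assms by (simp_all add: F_def mult.assoc)
  qed
  have der: "(F has_real_derivative sqrt (b / u)) (at u)" if "0 < u" for u
    unfolding F_def using that assms
    by (auto intro!: derivative_eq_intros simp: real_sqrt_divide field_simps)
  have "set_integrable lborel (einterval (ereal 0) (ereal b)) (\<lambda>u. sqrt (b / u))"
    "(LBINT u=ereal 0..ereal b. sqrt (b / u)) = 2 * b - 0"
    by (rule interval_integral_FTC_nonneg[OF _ _ _ _ lim]; use assms der in \<open>auto intro!: continuous_intros\<close>)+
  then show "set_integrable lborel {0<..<b} (\<lambda>u. sqrt (b / u))" "(LINT u:{0<..<b}|lborel. sqrt (b / u)) = 2 * b"
    using assms by (simp_all add: interval_integral_Ioo)
qed

text \<open>Below \<open>b\<close> the quantile is at most \<open>- y\<close>, so Mills' ratio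
  bounds its derivative at \<open>v\<close> by \<open>1 / (y * v)\<close>, the derivative of
  \<open>ln v / y\<close>. The condition on \<open>b\<close> keeps \<open>y \<ge> 1\<close>.\<close>

lemma Phi_inv_tail:
  assumes b: "0 < b" "b < Phi (- 1)" and u: "0 < u" "u \<le> b"
  defines "y \<equiv> - Phi_inv b"
  shows "\<bar>Phi_inv u - Phi_inv b\<bar> \<le> ln (b / u) / y"
proof -
  have b1: "b < 1" using b Phi_less_1[of "- 1"] by simp
  have y: "y \<ge> 1"
    using Phi_inv_mono[of b "Phi (- 1)"] b Phi_less_1[of "- 1"] by (simp add: y_def)
  have "ln u / y - Phi_inv u \<le> ln b / y - Phi_inv b"
  proof (rule DERIV_nonneg_imp_nondecreasing[OF u(2)])
    fix v assume v: "u \<le> v" "v \<le> b"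
    define d where "d = std_normal_density (Phi_inv v)"
    have d: "d > 0" by (simp add: d_def normal_density_pos)
    have "y \<le> - Phi_inv v"
      using Phi_inv_mono[of v b] v u b1 by (simp add: y_def)
    then have "y * v \<le> - Phi_inv v * v"
      using v u by (intro mult_right_mono) auto
    also have "\<dots> \<le> d"
      using Phi_Mills[of "Phi_inv v"] v u b1 by (simp add: d_def Phi_Phi_inv)
    finally have "1 / d \<le> 1 / (y * v)"
      using y v u d by (intro divide_left_mono) auto
    moreover have "((\<lambda>v. ln v / y - Phi_inv v) has_real_derivative 1 / (y * v) - 1 / d) (at v)"
      unfolding d_def using v u b1 y
      by (auto intro!: derivative_eq_intros Phi_inv_deriv simp: field_simps)
    ultimately show "\<exists>z. ((\<lambda>v. ln v / y - Phi_inv v) has_real_derivative z) (at v) \<and> 0 \<le> z"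
      by force
  qed
  then show ?thesis
    using Phi_inv_mono[of u b] u b1 b y by (simp add: ln_div diff_divide_distrib)
qed

text \<open>Bounding the logarithm by the power of exponent \<open>1 / (2 * s)\<close> makes its \<open>s\<close>-th power integrable at \<open>0\<close>.\<close>

lemma Phi_inv_tail_powr:
  assumes s: "0 < s" and b: "0 < b" "b < Phi (- 1)" and u: "0 < u" "u \<le> b"
  defines "y \<equiv> - Phi_inv b"
  shows "\<bar>Phi_inv u - Phi_inv b\<bar> powr s \<le> (2 * s / y) powr s * sqrt (b / u)"
proof -
  have y: "y \<ge> 1"
    using Phi_inv_mono[of b "Phi (- 1)"] b Phi_less_1[of "- 1"] by (simp add: y_def)
  have "\<bar>Phi_inv u - Phi_inv b\<bar> \<le> ln (b / u) / y"
    unfolding y_def by (rule Phi_inv_tail[OF b u])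
  also have "\<dots> \<le> ((b / u) powr (1 / (2 * s)) / (1 / (2 * s))) / y"
    using ln_powr_bound[of "b / u" "1 / (2 * s)"] u s y by (intro divide_right_mono) auto
  also have "\<dots> = 2 * s / y * (b / u) powr (1 / (2 * s))"
    by simp
  finally have "\<bar>Phi_inv u - Phi_inv b\<bar> powr s \<le> (2 * s / y * (b / u) powr (1 / (2 * s))) powr s"
    using s by (intro powr_mono2) auto
  also have "\<dots> = (2 * s / y) powr s * sqrt (b / u)"
    using s y u by (subst powr_mult) (auto simp: powr_powr powr_half_sqrt)
  finally show ?thesis .
qed

text \<open>The comparison polynomial is the constant \<open>Phi_inv b\<close>, whose mean square
  error over the interval is of order \<open>1 / y\<^sup>2\<close>.\<close>

lemma best_linear_last:
  assumes r: "0 < r" and b: "r ^ (K - 1) / 2 < Phi (- 1)"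
  defines "b \<equiv> r ^ (K - 1) / 2"
  defines "y \<equiv> - Phi_inv b"
  assumes u: "u \<in> {0<..<b}"
  shows "\<bar>poly (best_linear r K K) u - Phi_inv b\<bar> \<le> 23 / y"
proof -
  have I: "geometric_interval r K K = {0<..<b}"
    by (simp add: geometric_interval_def b_def)
  have b0: "0 < b" "b < Phi (- 1)" "b < 1" using r b Phi_less_1[of "- 1"] by (auto simp: b_def)
  have y: "y \<ge> 1"
    using Phi_inv_mono[of b "Phi (- 1)"] b0 Phi_less_1[of "- 1"] by (simp add: y_def)
  interpret bounded_interval 0 b "geometric_interval r K K"
    by unfold_locales (use b0 I in auto)
  have meas: "set_borel_measurable lborel {0<..<b} Phi_inv"
    by (rule Phi_inv_measurable) (use b0 in auto)
  note sq = sqrt_singularity_integral[OF b0(1)]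
  \<comment> \<open>Exponent 2 in \<open>Phi_inv_tail_powr\<close> yields the factor
    \<open>(4 / y)\<^sup>2\<close>.\<close>
  have tail: "(Phi_inv u - Phi_inv b)\<^sup>2 \<le> 16 / y\<^sup>2 * sqrt (b / u)" if "u \<in> {0<..<b}" for u
    using Phi_inv_tail_powr[of 2 b u] that b0 y by (simp add: y_def[symmetric] power_divide)
  have [measurable]: "(\<lambda>u. indicator {0<..<b} u * Phi_inv u) \<in> borel_measurable borel"
    using meas by (simp add: set_borel_measurable_def)
  have int: "set_integrable lborel {0<..<b} (\<lambda>u. (Phi_inv u)\<^sup>2)"
  proof (rule set_integrable_bound)
    show "set_integrable lborel {0<..<b} (\<lambda>u. 2 * (Phi_inv b)\<^sup>2 + 32 / y\<^sup>2 * sqrt (b / u))"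
      using sq(1) integral_const(1) I by (intro set_integral_add) auto
    have "(\<lambda>u. indicator {0<..<b} u * (Phi_inv u)\<^sup>2) = (\<lambda>u. (indicator {0<..<b} u * Phi_inv u)\<^sup>2)"
      by (auto simp: indicator_def)
    then show "set_borel_measurable lborel {0<..<b} (\<lambda>u. (Phi_inv u)\<^sup>2)"
      by (simp add: set_borel_measurable_def)
    have "(Phi_inv u)\<^sup>2 \<le> 2 * (Phi_inv b)\<^sup>2 + 32 / y\<^sup>2 * sqrt (b / u)" if "u \<in> {0<..<b}" for u
    proof -
      have "(Phi_inv u)\<^sup>2 \<le> 2 * (Phi_inv b)\<^sup>2 + 2 * (Phi_inv u - Phi_inv b)\<^sup>2"
        using zero_le_power2[of "Phi_inv u - 2 * Phi_inv b"] by (simp add: power2_eq_square algebra_simps)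
      with tail[OF that] show ?thesis by simp
    qed
    then show "AE u in lborel. u \<in> {0<..<b} \<longrightarrow> norm ((Phi_inv u)\<^sup>2) \<le> norm (2 * (Phi_inv b)\<^sup>2 + 32 / y\<^sup>2 * sqrt (b / u))"
      by fastforce
  qed
  note min = best_linear_is_arg_min[OF bounded_interval_axioms, unfolded I, OF meas int]
  define T where "T = [:Phi_inv b:]"
  have T: "degree T \<le> 1" by (simp add: T_def)
  have "(LINT u:{0<..<b}|lborel. (Phi_inv u - poly T u)\<^sup>2) \<le> (LINT u:{0<..<b}|lborel. 16 / y\<^sup>2 * sqrt (b / u))"
    using sub_poly_square_integrable[unfolded I, OF meas int T] sq(1) tail
    by (intro set_integral_mono) (auto simp: T_def)
  also have "\<dots> = 32 * b / y\<^sup>2"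
    by (simp add: sq(2))
  finally have "16 / (b - 0) * (LINT u:{0<..<b}|lborel. (Phi_inv u - poly T u)\<^sup>2) \<le> 16 / (b - 0) * (32 * b / y\<^sup>2)"
    using b0 by (intro mult_left_mono) auto
  also have "\<dots> = 512 / y\<^sup>2"
    using b0 by simp
  \<comment> \<open>23 is the least integer whose square, 529, exceeds 512.\<close>
  also have "\<dots> \<le> (23 / y)\<^sup>2"
    by (simp add: power_divide divide_right_mono)
  finally have "(poly (best_linear r K K) u - poly T u)\<^sup>2 \<le> (23 / y)\<^sup>2"
    using best_linear_near[unfolded I, OF meas int min T, of u] u by simp
  then have "\<bar>poly (best_linear r K K) u - poly T u\<bar> \<le> 23 / y"
    using y abs_le_square_iff[of _ "23 / y"] by simp
  then show ?thesis by (simp add: T_def)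
qed

text \<open>The error splits at \<open>Phi_inv b\<close>: the approximant is uniformly within
  \<open>23 / y\<close> of it, and the quantile itself is controlled by the square root
  majorant.\<close>

lemma best_linear_last_powr:
  assumes p: "0 < p" and r: "0 < r" and b: "r ^ (K - 1) / 2 < Phi (- 1)"
  defines "b \<equiv> r ^ (K - 1) / 2"
  defines "y \<equiv> - Phi_inv b"
  shows "set_integrable lborel {0<..<b} (\<lambda>u. \<bar>poly (best_linear r K K) u - Phi_inv u\<bar> powr p)" (is ?int)
    and "(LINT u:{0<..<b}|lborel. \<bar>poly (best_linear r K K) u - Phi_inv u\<bar> powr p)
           \<le> 2 powr p * (23 powr p + 2 * (2 * p) powr p) * (b * y powr (- p))" (is ?le)
proof -
  have b0: "0 < b" "b < Phi (- 1)" "b < 1" using r b Phi_less_1[of "- 1"] by (auto simp: b_def)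
  have y: "y \<ge> 1"
    using Phi_inv_mono[of b "Phi (- 1)"] b0 Phi_less_1[of "- 1"] by (simp add: y_def)
  interpret bounded_interval 0 b "{0<..<b}"
    by unfold_locales (use b0 in auto)
  note sq = sqrt_singularity_integral[OF b0(1)]
  define D where "D = poly (best_linear r K K)"
  define g where "g u = (46 / y) powr p + (4 * p / y) powr p * sqrt (b / u)" for u
  have le: "\<bar>D u - Phi_inv u\<bar> powr p \<le> g u" if u: "u \<in> {0<..<b}" for u
  proof -
    \<comment> \<open>Passing through the maximum gives a triangle inequality for
      \<open>p\<close>-th powers at the cost of \<open>2 powr p\<close>, which turns 23 into 46 and
      \<open>2 * p\<close> into \<open>4 * p\<close>.\<close>
    define m where "m = max \<bar>D u - Phi_inv b\<bar> \<bar>Phi_inv u - Phi_inv b\<bar>"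
    have "\<bar>D u - Phi_inv u\<bar> powr p \<le> (2 * m) powr p"
    proof (rule powr_mono2)
      have "\<bar>D u - Phi_inv b\<bar> \<le> m" "\<bar>Phi_inv u - Phi_inv b\<bar> \<le> m"
        by (simp_all add: m_def)
      then show "\<bar>D u - Phi_inv u\<bar> \<le> 2 * m" by linarith
    qed (use p in auto)
    also have "\<dots> = 2 powr p * m powr p"
      by (simp add: powr_mult m_def)
    also have "m powr p \<le> \<bar>D u - Phi_inv b\<bar> powr p + \<bar>Phi_inv u - Phi_inv b\<bar> powr p"
      by (simp add: m_def max_def)
    also have "\<bar>D u - Phi_inv b\<bar> powr p \<le> (23 / y) powr p"
      using best_linear_last[OF r b] u p by (intro powr_mono2) (auto simp: D_def b_def y_def)
    also have "\<bar>Phi_inv u - Phi_inv b\<bar> powr p \<le> (2 * p / y) powr p * sqrt (b / u)"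
      using Phi_inv_tail_powr[OF p b0(1,2), of u] u by (simp add: y_def)
    also have "2 powr p * ((23 / y) powr p + (2 * p / y) powr p * sqrt (b / u)) = g u"
      using y p by (simp add: g_def powr_mult[symmetric] distrib_left mult.assoc[symmetric])
    finally show ?thesis by simp
  qed
  have g: "set_integrable lborel {0<..<b} g"
    unfolding g_def using sq(1) integral_const(1) by (intro set_integral_add) auto
  have "set_borel_measurable lborel {0<..<b} (\<lambda>u. \<bar>D u - Phi_inv u\<bar> powr p)"
    unfolding D_def by (rule linear_error_measurable) (use b0 p in auto)
  moreover have "AE u in lborel. u \<in> {0<..<b} \<longrightarrow> norm (\<bar>D u - Phi_inv u\<bar> powr p) \<le> norm (g u)"
    using le by fastforce
  ultimately have int: "set_integrable lborel {0<..<b} (\<lambda>u. \<bar>D u - Phi_inv u\<bar> powr p)"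
    using set_integrable_bound[OF g] by blast
  then show ?int by (simp add: D_def)
  have "(LINT u:{0<..<b}|lborel. \<bar>D u - Phi_inv u\<bar> powr p) \<le> (LINT u:{0<..<b}|lborel. g u)"
    by (intro set_integral_mono int g le)
  also have "\<dots> = b * (46 / y) powr p + (4 * p / y) powr p * (2 * b)"
    unfolding g_def using integral_const(1) sq by (simp add: set_integral_add integral_const(2))
  also have "\<dots> = 2 powr p * (23 powr p + 2 * (2 * p) powr p) * (b * y powr (- p))"
  proof -
    have "46 powr p = (2::real) powr p * 23 powr p" "(4 * p) powr p = 2 powr p * (2 * p) powr p"
      using p by (simp_all add: powr_mult[symmetric])
    then show ?thesis
      using y p by (simp add: powr_divide powr_minus field_simps)
  qed
  finally show ?le by (simp add: D_def)
qed

section \<open>The total error\<close>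

lemma geometric_interval_sets [measurable]: "geometric_interval r K k \<in> sets borel"
  by (simp add: geometric_interval_def)

lemma geometric_interval_cover:
  assumes r: "0 < r" "r < 1" and K: "1 \<le> K"
  shows "(\<Union>k\<in>{1..<K}. geometric_interval r K k) = {r ^ (K - 1) / 2..<1 / 2}"
proof (intro equalityI subsetI)
  fix u assume "u \<in> (\<Union>k\<in>{1..<K}. geometric_interval r K k)"
  then obtain k where k: "1 \<le> k" "k < K" "r ^ k / 2 \<le> u" "u < r ^ (k - 1) / 2"
    by (auto simp: geometric_interval_def)
  moreover have "r ^ (K - 1) \<le> r ^ k" "r ^ (k - 1) \<le> 1"
    using k r by (auto intro!: power_decreasing power_le_one)
  ultimately show "u \<in> {r ^ (K - 1) / 2..<1 / 2}"
    by auto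
next
  fix u assume u: "u \<in> {r ^ (K - 1) / 2..<1 / 2}"
  have "\<exists>k\<in>{1..n}. r ^ k / 2 \<le> u \<and> u < r ^ (k - 1) / 2" if "r ^ n / 2 \<le> u" for n
    using that
  proof (induction n)
    case (Suc n)
    \<comment> \<open>Either \<open>u\<close> already lies above the previous breakpoint and
      induction applies, or \<open>k = Suc n\<close> works. At 0 the assumption contradicts
      \<open>u < 1 / 2\<close>.\<close>
    then show ?case
      by (cases "r ^ n / 2 \<le> u") force+
  qed (use u in simp)
  from this[of "K - 1"] u K obtain k where "k \<in> {1..K - 1}" "r ^ k / 2 \<le> u" "u < r ^ (k - 1) / 2"
    by auto
  with K show "u \<in> (\<Union>k\<in>{1..<K}. geometric_interval r K k)"
    by (auto simp: geometric_interval_def intro!: bexI[of _ k])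
qed

text \<open>The error is invariant under \<open>u \<mapsto> 1 - u\<close>, so the integrand is the
  sum of its left half and the reflection of that half.\<close>

lemma antisymmetric_error_integral:
  fixes f g :: "real \<Rightarrow> real"
  assumes f: "\<And>u. u \<in> {0<..<1} \<Longrightarrow> f (1 - u) = - f u"
    and g: "\<And>u. u \<in> {0<..<1} \<Longrightarrow> g (1 - u) = - g u"
    and int: "set_integrable lborel {0<..<1 / 2} (\<lambda>u. \<bar>f u - g u\<bar> powr p)"
  shows "set_integrable lborel {0<..<1} (\<lambda>u. \<bar>f u - g u\<bar> powr p)"
    and "(LINT u:{0<..<1}|lborel. \<bar>f u - g u\<bar> powr p) = 2 * (LINT u:{0<..<1 / 2}|lborel. \<bar>f u - g u\<bar> powr p)"
proof -
  define e where "e u = \<bar>f u - g u\<bar> powr p" for u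
  define G where "G u = indicator {0<..<1 / 2} u * e u" for u
  have sym: "e (1 - u) = e u" if "u \<in> {0<..<1}" for u
    using f[OF that] g[OF that] by (simp add: e_def abs_minus_commute)
  \<comment> \<open>Antisymmetry forces both functions to vanish at the fixed point, so the
    splitting below holds at every point.\<close>
  have half: "e u = 0" if "u * 2 = 1" for u
  proof -
    have "u \<in> {0<..<1}" "1 - u = u"
      using that by auto
    then show ?thesis
      using f[of u] g[of u] unfolding \<open>1 - u = u\<close> by (simp add: e_def)
  qed
  have eq: "indicator {0<..<1} u * e u = G u + G (1 + - 1 * u)" for u
  proof -
    consider "u \<notin> {0<..<1}" | "u \<in> {0<..<1 / 2}" | "u = 1 / 2" | "u \<in> {1 / 2<..<1}"
      by fastforce
    then show ?thesis
      by cases (use sym[of u] half in \<open>auto simp: G_def indicator_def\<close>)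
  qed
  have G: "integrable lborel G"
    using int by (simp add: set_integrable_def G_def[abs_def] e_def)
  then have G': "integrable lborel (\<lambda>u. G (1 + - 1 * u))"
    by (rule lborel_integrable_real_affine) simp
  show "set_integrable lborel {0<..<1} (\<lambda>u. \<bar>f u - g u\<bar> powr p)"
    using Bochner_Integration.integrable_add[OF G G'] unfolding eq[symmetric]
    by (simp add: set_integrable_def e_def)
  have "(LINT u:{0<..<1}|lborel. e u) = integral\<^sup>L lborel G + (\<integral>u. G (1 + - 1 * u) \<partial>lborel)"
    using Bochner_Integration.integral_add[OF G G'] unfolding eq[symmetric]
    by (simp add: set_lebesgue_integral_def)
  also have "\<dots> = 2 * (LINT u:{0<..<1 / 2}|lborel. e u)"
    using lborel_integral_real_affine[of "- 1" G 1] by (simp add: set_lebesgue_integral_def G_def[abs_def])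
  finally show "(LINT u:{0<..<1}|lborel. \<bar>f u - g u\<bar> powr p) = 2 * (LINT u:{0<..<1 / 2}|lborel. \<bar>f u - g u\<bar> powr p)"
    by (simp add: e_def)
qed

text \<open>The middle bound is uniform in \<open>k\<close>, and those intervals have total length
  at most 1/2, so summing over \<open>k\<close> costs nothing. Doubling by symmetry cancels this 1/2
  and leaves the factor 2 on the last interval.\<close>

lemma approximant_error:
  assumes p: "0 < p" and r: "1 / 2 \<le> r" "r < 1" and K: "1 \<le> K" and b: "r ^ (K - 1) / 2 < Phi (- 1)"
    and D: "is_approximant r K D"
  defines "b \<equiv> r ^ (K - 1) / 2"
  shows "set_integrable lborel {0<..<1} (\<lambda>u. \<bar>D u - Phi_inv u\<bar> powr p)" (is ?int)
    and "(LINT u:{0<..<1}|lborel. \<bar>D u - Phi_inv u\<bar> powr p)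
       \<le> (10 / std_normal_density (- 1)) powr p * (1 - r) powr (2 * p)
         + 2 * (2 powr p * (23 powr p + 2 * (2 * p) powr p)) * (b * (- Phi_inv b) powr (- p))" (is "_ \<le> ?A + 2 * ?C * ?B")
proof -
  define E where "E = 10 / std_normal_density (- 1) * (1 - r)\<^sup>2"
  define e where "e u = \<bar>D u - Phi_inv u\<bar> powr p" for u
  have "Phi (- 1) < 1 / 2"
    using strict_monoD[OF Phi_strict_mono, of "- 1" 0] Phi_minus[of 0] by simp
  then have b0: "0 < b" "b < 1 / 2"
    using r b by (auto simp: b_def)
  interpret bounded_interval b "1 / 2" "{b..<1 / 2}"
    by unfold_locales (use b0 in auto)
  have cover: "(\<Union>k\<in>{1..<K}. geometric_interval r K k) = {b..<1 / 2}"
    unfolding b_def by (rule geometric_interval_cover) (use r K in auto)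
  have D_eq: "D u = poly (best_linear r K k) u" if "k \<in> {1..K}" "u \<in> geometric_interval r K k" for k u
    using D that by (auto simp: is_approximant_def)
  have middle: "e u \<le> E powr p" if "k \<in> {1..<K}" "u \<in> geometric_interval r K k" for k u
    using best_linear_middle[OF r, of k K u] D_eq[of k u] that p
    by (auto simp: e_def E_def intro!: powr_mono2)
  have int1: "set_integrable lborel (geometric_interval r K k) e" if k: "k \<in> {1..<K}" for k
  proof (rule set_integrable_bound)
    have sub: "geometric_interval r K k \<subseteq> {b..<1 / 2}"
      using cover k by blast
    then show "set_integrable lborel (geometric_interval r K k) (\<lambda>u. E powr p)"
      by (intro set_integrable_subset[OF integral_const(1)]) auto
    have "set_borel_measurable lborel (geometric_interval r K k) (\<lambda>u. \<bar>poly (best_linear r K k) u - Phi_inv u\<bar> powr p)"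
      by (rule linear_error_measurable) (use sub b0 p in auto)
    also have "?this \<longleftrightarrow> set_borel_measurable lborel (geometric_interval r K k) e"
      unfolding set_borel_measurable_def
      by (intro measurable_cong) (use D_eq[of k] k in \<open>auto simp: e_def indicator_def\<close>)
    finally show "set_borel_measurable lborel (geometric_interval r K k) e" .
    show "AE u in lborel. u \<in> geometric_interval r K k \<longrightarrow> norm (e u) \<le> norm (E powr p)"
      using middle[OF k] by (simp add: e_def)
  qed
  have int_middle: "set_integrable lborel {b..<1 / 2} e"
    unfolding cover[symmetric] by (rule set_integrable_UN) (use int1 in auto)
  have "(LINT u:{b..<1 / 2}|lborel. e u) \<le> (LINT u:{b..<1 / 2}|lborel. E powr p)"
    by (rule set_integral_mono[OF int_middle integral_const(1)]) (use cover middle in blast)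
  also have "\<dots> \<le> 1 / 2 * E powr p"
    unfolding integral_const(2) using b0 by (intro mult_right_mono) auto
  also have "E powr p = ?A"
    unfolding E_def
    by (subst powr_mult) (use r in \<open>simp_all add: normal_density_nonneg powr_powr powr_numeral[symmetric] del: powr_numeral\<close>)
  finally have le_middle: "(LINT u:{b..<1 / 2}|lborel. e u) \<le> 1 / 2 * ?A" .
  have "geometric_interval r K K = {0<..<b}"
    by (simp add: geometric_interval_def b_def)
  then have last: "e u = \<bar>poly (best_linear r K K) u - Phi_inv u\<bar> powr p" if "u \<in> {0<..<b}" for u
    using D_eq[of K u] K that by (simp add: e_def)
  have r0: "0 < r" using r by simp
  have int_last: "set_integrable lborel {0<..<b} e"
    using best_linear_last_powr(1)[OF p r0 b] last unfolding b_def[symmetric]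
    by (subst set_integrable_cong[OF refl refl]) auto
  have "(LINT u:{0<..<b}|lborel. e u) = (LINT u:{0<..<b}|lborel. \<bar>poly (best_linear r K K) u - Phi_inv u\<bar> powr p)"
    using last by (intro set_lebesgue_integral_cong) auto
  then have le_last: "(LINT u:{0<..<b}|lborel. e u) \<le> ?C * ?B"
    using best_linear_last_powr(2)[OF p r0 b] unfolding b_def[symmetric] by simp
  have half: "{0<..<1 / 2} = {0<..<b} \<union> {b..<1 / 2}"
    using b0 by auto
  have int: "set_integrable lborel {0<..<1 / 2} e"
    unfolding half by (intro set_integrable_Un int_last int_middle) auto
  have D_anti: "D (1 - u) = - D u" if "u \<in> {0<..<1}" for u
    using D that by (auto simp: is_approximant_def)
  note sym = antisymmetric_error_integral[OF D_anti Phi_inv_symmetric int[unfolded e_def]]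
  show ?int by (rule sym(1))
  have "(LINT u:{0<..<1 / 2}|lborel. e u) = (LINT u:{0<..<b}|lborel. e u) + (LINT u:{b..<1 / 2}|lborel. e u)"
    unfolding half by (rule set_integral_Un) (use int_last int_middle in auto)
  with le_middle le_last show "(LINT u:{0<..<1}|lborel. \<bar>D u - Phi_inv u\<bar> powr p) \<le> ?A + 2 * ?C * ?B"
    using sym(2) by (simp add: e_def)
qed

section \<open>Logarithmic form of the tail and the joint limit\<close>

text \<open>The logarithm is that of \<open>1 / (b * sqrt (2 * pi))\<close>, so the lower bound for
  the Gaussian tail reads \<open>L \<le> (y + 1)\<^sup>2 / 2\<close>. The negative exponent reverses
  the inequality.\<close>

lemma Phi_inv_log_bound:
  assumes "0 < p" and r: "0 < r" and b: "r ^ (K - 1) / 2 < Phi (- 1)" "r ^ (K - 1) < 1 / 2" and K: "1 \<le> K"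
  defines "b \<equiv> r ^ (K - 1) / 2"
  defines "L \<equiv> ln (r powi (1 - int K) * sqrt (2 / pi))"
  shows "(- Phi_inv b) powr (- p) \<le> 2 powr (p / 2) * L powr (- p / 2)"
proof -
  define y where "y = - Phi_inv b"
  have b0: "0 < b" "b < Phi (- 1)" "b < 1" using r b Phi_less_1[of "- 1"] by (auto simp: b_def)
  have y: "y \<ge> 1"
    using Phi_inv_mono[of b "Phi (- 1)"] b0 Phi_less_1[of "- 1"] by (simp add: y_def)
  have "int K - 1 = int (K - 1)"
    using K by simp
  then have "r powi (1 - int K) = 1 / r ^ (K - 1)"
    by (metis minus_diff_eq power_int_minus_divide power_int_of_nat)
  also have "\<dots> = 1 / (2 * b)"
    by (simp add: b_def)
  finally have powi: "r powi (1 - int K) = 1 / (2 * b)" .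
  have sqrt_eq: "sqrt (2 / pi) = 2 / sqrt (2 * pi)"
    by (simp add: real_sqrt_divide real_sqrt_mult field_simps)
  have L_eq: "r powi (1 - int K) * sqrt (2 / pi) = 1 / (b * sqrt (2 * pi))"
    unfolding powi sqrt_eq by simp
  \<comment> \<open>Here \<open>b < 1 / 4\<close> and \<open>sqrt (2 * pi) < 4\<close> make
    \<open>L\<close> positive, which the monotonicity of negative powers requires.\<close>
  have "sqrt (2 * pi) < sqrt (4\<^sup>2)"
    using pi_less_4 by (intro real_sqrt_less_mono) simp
  then have "b * sqrt (2 * pi) < 1 / 4 * 4"
    using b b0 by (intro mult_strict_mono) (auto simp: b_def)
  then have L0: "L > 0"
    unfolding L_def L_eq using b0 by (intro ln_gt_zero) (simp add: field_simps)
  have "exp (- (y + 1)\<^sup>2 / 2) / sqrt (2 * pi) \<le> b"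
    using Phi_lower_bound[of y] y b0 by (simp add: y_def Phi_Phi_inv std_normal_density_def)
  then have "exp (- (y + 1)\<^sup>2 / 2) \<le> b * sqrt (2 * pi)"
    by (simp add: divide_le_eq)
  then have "ln (exp (- (y + 1)\<^sup>2 / 2)) \<le> ln (b * sqrt (2 * pi))"
    by (intro ln_mono) (use b0 in auto)
  then have "L \<le> (y + 1)\<^sup>2 / 2"
    unfolding L_def L_eq using b0 by (simp add: ln_div)
  also have "\<dots> \<le> (2 * y)\<^sup>2 / 2"
    using y by (intro divide_right_mono power_mono) auto
  finally have "L / 2 \<le> y\<^sup>2"
    by (simp add: power_mult_distrib)
  then have "(y\<^sup>2) powr (- p / 2) \<le> (L / 2) powr (- p / 2)"
    using L0 \<open>0 < p\<close> by (intro powr_mono2') auto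
  also have "\<dots> = 2 powr (p / 2) * L powr (- p / 2)"
    using L0 by (simp add: powr_divide powr_minus_divide)
  also have "(y\<^sup>2) powr (- p / 2) = y powr (- p)"
    using y by (simp add: powr_powr powr_numeral[symmetric] del: powr_numeral)
  finally show ?thesis by (simp add: y_def)
qed

text \<open>Membership in a sum of classes asks for an explicit decomposition: \<open>h\<close> is
  clamped to size \<open>A * \<bar>f x\<bar>\<close>, and what remains is at most
  \<open>B * \<bar>g x\<bar>\<close>.\<close>

lemma bigo_plusI:
  fixes f g h :: "'a \<Rightarrow> real"
  assumes "eventually (\<lambda>x. \<bar>h x\<bar> \<le> A * \<bar>f x\<bar> + B * \<bar>g x\<bar>) F" "0 \<le> A" "0 \<le> B"
  shows "h \<in> O[F](f) + O[F](g)"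
proof -
  define h1 where "h1 x = max (- A * \<bar>f x\<bar>) (min (A * \<bar>f x\<bar>) (h x))" for x
  have "h1 \<in> O[F](f)"
    by (rule bigoI[of _ A]) (use assms(2) in \<open>auto simp: h1_def abs_le_iff intro!: always_eventually\<close>)
  moreover have "h - h1 \<in> O[F](g)"
  proof (rule bigoI[of _ B])
    show "eventually (\<lambda>x. norm ((h - h1) x) \<le> B * norm (g x)) F"
      using assms(1)
    proof eventually_elim
      case (elim x)
      then show ?case
        using assms(2,3) by (auto simp: h1_def max_def min_def abs_if mult_le_0_iff zero_le_mult_iff split: if_splits)
    qed
  qed
  ultimately have "h1 + (h - h1) \<in> O[F](f) + O[F](g)"
    by (rule set_plus_intro)
  then show ?thesis by simp
qed

text \<open>This lets asymptotics in the single variable \<open>r ^ (K - 1)\<close> be pulled back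
  to the joint regime.\<close>

lemma regime_at_right_0: "filterlim (\<lambda>(r, K). r ^ (K - 1)) (at_right 0) regime"
proof -
  have "filterlim (\<lambda>(r, K). r ^ (K - 1)) (nhds 0) regime"
    unfolding filterlim_iff_le_filtercomap regime_def by (auto intro: le_infI1)
  moreover have "eventually (\<lambda>(r, K). r ^ (K - 1) \<in> {0<..} - {0 :: real}) regime"
    unfolding eventually_regime by (auto intro!: exI[of _ 1])
  ultimately show ?thesis
    by (auto simp: at_within_def filterlim_inf filterlim_principal case_prod_unfold)
qed

text \<open>With \<open>x = r ^ (K - 1)\<close> the logarithm tends to infinity as \<open>x\<close>
  tends to 0 from the right, so its negative power vanishes.\<close>

lemma regime_tail_smallo:
  assumes "0 < p"
  shows "(\<lambda>(r, K). r ^ (K - 1) * ln (r powi (1 - int K) * sqrt (2 / pi)) powr (- p / 2))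
           \<in> o[regime](\<lambda>(r, K). r ^ (K - 1))"
proof -
  have "(\<lambda>x::real. x * ln (inverse x * sqrt (2 / pi)) powr (- p / 2)) \<in> o[at_right 0](\<lambda>x. x)"
    using assms by real_asymp
  then have "(\<lambda>z. (case z of (r, K) \<Rightarrow> r ^ (K - 1)) * ln (inverse (case z of (r, K) \<Rightarrow> r ^ (K - 1)) * sqrt (2 / pi)) powr (- p / 2))
      \<in> o[regime](\<lambda>z. case z of (r, K) \<Rightarrow> r ^ (K - 1))"
    by (rule landau_o.small.compose[OF _ regime_at_right_0])
  moreover have "eventually (\<lambda>z. (case z of (r, K) \<Rightarrow> r ^ (K - 1)) * ln (inverse (case z of (r, K) \<Rightarrow> r ^ (K - 1)) * sqrt (2 / pi)) powr (- p / 2)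
      = (case z of (r, K) \<Rightarrow> r ^ (K - 1) * ln (r powi (1 - int K) * sqrt (2 / pi)) powr (- p / 2))) regime"
  proof -
    have "r powi (1 - int K) = inverse (r ^ (K - 1))" if "1 \<le> K" for r :: real and K
    proof -
      have "int K - 1 = int (K - 1)"
        using that by simp
      then show ?thesis
        by (metis minus_diff_eq power_int_minus power_int_of_nat)
    qed
    then show ?thesis
      unfolding eventually_regime by (auto intro!: exI[of _ 1])
  qed
  ultimately show ?thesis
    by (simp add: landau_o.small.in_cong)
qed

text \<open>Integrability is asserted separately because \<open>Lp_norm\<close> would otherwise hide
  a divergent integral behind the value 0. The last equality between error terms is read, as usual,
  as an inclusion of classes.\<close>

theorem theorem2p5:
  fixes p :: real and D :: "real \<Rightarrow> nat \<Rightarrow> real \<Rightarrow> real"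
  assumes "2 \<le> p"
    and "\<And>r K. 0 < r \<Longrightarrow> r < 1 \<Longrightarrow> 1 \<le> K \<Longrightarrow> is_approximant r K (D r K)"
  shows "(\<forall>\<^sub>F (r, K) in regime.
            set_integrable lborel {0<..<1} (\<lambda>u. \<bar>D r K u - Phi_inv u\<bar> powr p)) \<and>
    (\<lambda>(r, K). Lp_norm p (\<lambda>u. D r K u - Phi_inv u) powr p)
      \<in> O[regime](\<lambda>(r, K). (1 - r) powr (2 * p))
        + O[regime](\<lambda>(r, K). r ^ (K - 1) * ln (r powi (1 - int K) * sqrt (2 / pi)) powr (- p / 2)) \<and>
    O[regime](\<lambda>(r, K). (1 - r) powr (2 * p))
        + O[regime](\<lambda>(r, K). r ^ (K - 1) * ln (r powi (1 - int K) * sqrt (2 / pi)) powr (- p / 2))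
      \<subseteq> O[regime](\<lambda>(r, K). (1 - r) powr (2 * p)) + o[regime](\<lambda>(r, K). r ^ (K - 1))"
proof (intro conjI)
  have p: "0 < p" using assms(1) by simp
  \<comment> \<open>The bound \<open>2 * Phi (- 1)\<close> puts half of \<open>r ^ (K - 1)\<close>
    below \<open>Phi (- 1)\<close>, and \<open>1 / 2\<close> keeps the logarithm positive.\<close>
  define \<epsilon> where "\<epsilon> = min (1 / 2) (2 * Phi (- 1))"
  have \<epsilon>: "\<epsilon> > 0" using Phi_pos by (simp add: \<epsilon>_def)
  define A where "A = (10 / std_normal_density (- 1)) powr p"
  define C where "C = 2 powr p * (23 powr p + 2 * (2 * p) powr p)"
  define B where "B = C * 2 powr (p / 2)"
  have nonneg: "0 \<le> A" "0 \<le> C" "0 \<le> B" by (simp_all add: A_def B_def C_def)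
  have bound: "set_integrable lborel {0<..<1} (\<lambda>u. \<bar>D r K u - Phi_inv u\<bar> powr p) \<and>
      (LINT u:{0<..<1}|lborel. \<bar>D r K u - Phi_inv u\<bar> powr p)
        \<le> A * (1 - r) powr (2 * p) + B * (r ^ (K - 1) * ln (r powi (1 - int K) * sqrt (2 / pi)) powr (- p / 2))"
    if rK: "0 < r \<and> r < 1 \<and> 1 \<le> K \<and> 1 - r < 1 / 2 \<and> r ^ (K - 1) < \<epsilon>" for r K
  proof -
    define b where "b = r ^ (K - 1) / 2"
    define L where "L = ln (r powi (1 - int K) * sqrt (2 / pi))"
    have r: "1 / 2 \<le> r" "r < 1" "0 < r" and K: "1 \<le> K" and b: "r ^ (K - 1) / 2 < Phi (- 1)" "r ^ (K - 1) < 1 / 2"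
      using rK by (auto simp: \<epsilon>_def)
    note err = approximant_error[OF p r(1,2) K b(1) assms(2)[OF r(3,2) K]]
    have "(- Phi_inv b) powr (- p) \<le> 2 powr (p / 2) * L powr (- p / 2)"
      unfolding b_def L_def by (rule Phi_inv_log_bound[OF p r(3) b K])
    then have "2 * C * (b * (- Phi_inv b) powr (- p)) \<le> 2 * C * (b * (2 powr (p / 2) * L powr (- p / 2)))"
      using nonneg r by (intro mult_left_mono) (auto simp: b_def)
    \<comment> \<open>The factor 2 from symmetry cancels against
      \<open>b = r ^ (K - 1) / 2\<close>.\<close>
    also have "\<dots> = B * (r ^ (K - 1) * L powr (- p / 2))"
      by (simp add: B_def b_def)
    finally show ?thesis
      using err unfolding A_def[symmetric] C_def[symmetric] b_def[symmetric] L_def[symmetric] by auto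
  qed
  show "\<forall>\<^sub>F (r, K) in regime. set_integrable lborel {0<..<1} (\<lambda>u. \<bar>D r K u - Phi_inv u\<bar> powr p)"
    unfolding eventually_regime by (rule exI[of _ "1 / 2"], simp, rule exI[of _ \<epsilon>]) (use bound \<epsilon> in auto)
  have norm_eq: "Lp_norm p f powr p = (LINT u:{0<..<1}|lborel. \<bar>f u\<bar> powr p)" for f
  proof -
    have "0 \<le> (LINT u:{0<..<1}|lborel. \<bar>f u\<bar> powr p)"
      unfolding set_lebesgue_integral_def by (intro integral_nonneg_AE) auto
    then show ?thesis
      using p by (simp add: Lp_norm_def powr_powr)
  qed
  show "(\<lambda>(r, K). Lp_norm p (\<lambda>u. D r K u - Phi_inv u) powr p)
      \<in> O[regime](\<lambda>(r, K). (1 - r) powr (2 * p))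
        + O[regime](\<lambda>(r, K). r ^ (K - 1) * ln (r powi (1 - int K) * sqrt (2 / pi)) powr (- p / 2))"
  proof (rule bigo_plusI[OF _ nonneg(1,3)])
    show "\<forall>\<^sub>F z in regime. \<bar>case z of (r, K) \<Rightarrow> Lp_norm p (\<lambda>u. D r K u - Phi_inv u) powr p\<bar>
        \<le> A * \<bar>case z of (r, K) \<Rightarrow> (1 - r) powr (2 * p)\<bar>
          + B * \<bar>case z of (r, K) \<Rightarrow> r ^ (K - 1) * ln (r powi (1 - int K) * sqrt (2 / pi)) powr (- p / 2)\<bar>"
      unfolding eventually_regime
    proof (rule exI[of _ "1 / 2"], simp only: prod.case, intro conjI exI[of _ \<epsilon>] allI impI)
      fix r K assume rK: "0 < r \<and> r < 1 \<and> 1 \<le> K \<and> 1 - r < 1 / 2 \<and> r ^ (K - 1) < \<epsilon>"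
      have "\<bar>Lp_norm p (\<lambda>u. D r K u - Phi_inv u) powr p\<bar> = Lp_norm p (\<lambda>u. D r K u - Phi_inv u) powr p"
        by simp
      also have "\<dots> = (LINT u:{0<..<1}|lborel. \<bar>D r K u - Phi_inv u\<bar> powr p)"
        by (rule norm_eq)
      also have "\<dots> \<le> A * (1 - r) powr (2 * p)
          + B * (r ^ (K - 1) * ln (r powi (1 - int K) * sqrt (2 / pi)) powr (- p / 2))"
        using bound[OF rK] by simp
      also have "\<dots> = A * \<bar>(1 - r) powr (2 * p)\<bar>
          + B * \<bar>r ^ (K - 1) * ln (r powi (1 - int K) * sqrt (2 / pi)) powr (- p / 2)\<bar>"
        using rK by (simp add: abs_mult)
      finally show "\<bar>Lp_norm p (\<lambda>u. D r K u - Phi_inv u) powr p\<bar> \<le> A * \<bar>(1 - r) powr (2 * p)\<bar>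
          + B * \<bar>r ^ (K - 1) * ln (r powi (1 - int K) * sqrt (2 / pi)) powr (- p / 2)\<bar>" .
    qed (use \<epsilon> in auto)
  qed
  show "O[regime](\<lambda>(r, K). (1 - r) powr (2 * p))
        + O[regime](\<lambda>(r, K). r ^ (K - 1) * ln (r powi (1 - int K) * sqrt (2 / pi)) powr (- p / 2))
      \<subseteq> O[regime](\<lambda>(r, K). (1 - r) powr (2 * p)) + o[regime](\<lambda>(r, K). r ^ (K - 1))"
    \<comment> \<open>Only the second summand changes: anything bounded by the tail term is
      negligible against \<open>r ^ (K - 1)\<close>.\<close>
    by (intro set_plus_mono2 order_refl subsetI) (rule landau_o.big_small_trans[OF _ regime_tail_smallo[OF p]])
qed

end
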